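(* Let $q>1$ be an integer, let $p_0,p_1,\dots,p_{q-1}\in(0,1)$ with $p_0+\dots+p_{q-1}=1$, let $\theta$ be a fixed permutation of $\{0,1,\dots,q-1\}$, and let $f\in S_q$ be the associated function on $[0,1]$, $f(\Delta^{P_q}_{i_1i_2\ldots i_k\ldots})=\Delta^{P_q}_{\theta(i_1)\theta(i_2)\ldots\theta(i_k)\ldots}$. For $t=0,1,\dots,q-1$ let $\psi_t:\mathbb{R}^2\to\mathbb{R}^2$ be the affine transformation $$\psi_t:\ \begin{cases} x'=p_tx+\beta_t,\\ y'=p_{\theta(t)}y+\beta_{\theta(t)}.\end{cases}$$ Then the graph $\Gamma$ of $f$ is a self-affine set of $\mathbb{R}^2$, and $$\Gamma=\bigcup_{t=0}^{q-1}\psi_t(\Gamma).$$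
   Context: Put $P_q=\{p_0,\dots,p_{q-1}\}$, $\beta_0=0$ and $\beta_t=\sum_{l=0}^{t-1}p_l$ for $t=1,\dots,q-1$. For a digit sequence $(i_k)_{k\ge1}$ in $\{0,\dots,q-1\}$ define $$\Delta^{P_q}_{i_1i_2\ldots i_k\ldots}=\beta_{i_1}+\sum_{k=2}^{\infty}\Big(\beta_{i_k}\prod_{r=1}^{k-1}p_{i_r}\Big)\in[0,1],$$ called the $P_q$-representation of this number. A digit $c$ in parentheses, $(c)$, means that $c$ is repeated forever. Every $x\in[0,1]$ has a $P_q$-representation, unique except for the numbers $\Delta^{P_q}_{i_1\ldots i_{m-1}i_m(0)}=\Delta^{P_q}_{i_1\ldots i_{m-1}[i_m-1](q-1)}$ with $i_m\neq0$. Convention: to make $f$ well defined, representations of the argument with period $(q-1)$ are not used, except for the number $1=\Delta^{P_q}_{(q-1)}$. $S_q$ is the class of the $q!$ functions $f_\theta:[0,1]\to[0,1]$, $f_\theta(\Delta^{P_q}_{i_1i_2\ldots})=\Delta^{P_q}_{\theta(i_1)\theta(i_2)\ldots}$, where $\theta$ runs over the permutations of $\{0,\dots,q-1\}$. The graph is $\Gamma=\{(x,f(x)):x\in[0,1]\}$.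
   Formalization: The printed equality fails for q=3, p=(1/3,1/3,1/3), θ=(0 1). Proved instead: the union of the ψ_t(Γ) is Γ plus the points ψ_t(1,f(1)), t<q−1; self-affinity and the printed equality hold for the graph over [0,1) and for the closure of Γ. *)

theory Defs
  imports "HOL-Analysis.Analysis" "HOL-Combinatorics.Permutations"
begin

definition Pq_beta :: "(nat \<Rightarrow> real) \<Rightarrow> nat \<Rightarrow> real" where
  "Pq_beta p t = (\<Sum>l<t. p l)"

text \<open>
  Digit sequences are indexed from 0, so \<open>i k\<close> is the digit usually written with index \<open>k + 1\<close>;
  the term for \<open>k = 0\<close> has an empty product.
\<close>

definition Pq_value :: "(nat \<Rightarrow> real) \<Rightarrow> (nat \<Rightarrow> nat) \<Rightarrow> real" where
  "Pq_value p i = (\<Sum>k. Pq_beta p (i k) * (\<Prod>r<k. p (i r)))"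

text \<open>
  Sequences with period \<open>(q - 1)\<close> are excluded, except for the constant one, which represents 1.
\<close>

definition Pq_admissible :: "nat \<Rightarrow> (nat \<Rightarrow> nat) \<Rightarrow> bool" where
  "Pq_admissible q i \<longleftrightarrow> (\<forall>k. i k < q) \<and>
     ((\<forall>k. i k = q - 1) \<or> \<not> (\<exists>m. \<forall>k\<ge>m. i k = q - 1))"

definition Pq_digits :: "(nat \<Rightarrow> real) \<Rightarrow> nat \<Rightarrow> real \<Rightarrow> nat \<Rightarrow> nat" where
  "Pq_digits p q x = (THE i. Pq_admissible q i \<and> Pq_value p i = x)"

text \<open>Only meaningful for arguments in \<open>[0, 1]\<close>.\<close>

definition Sq_fun :: "(nat \<Rightarrow> real) \<Rightarrow> nat \<Rightarrow> (nat \<Rightarrow> nat) \<Rightarrow> real \<Rightarrow> real" where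
  "Sq_fun p q \<theta> x = Pq_value p (\<theta> \<circ> Pq_digits p q x)"

definition graph_on :: "real set \<Rightarrow> (real \<Rightarrow> real) \<Rightarrow> (real \<times> real) set" where
  "graph_on D f = (\<lambda>x. (x, f x)) ` D"

definition Sq_affine :: "(nat \<Rightarrow> real) \<Rightarrow> (nat \<Rightarrow> nat) \<Rightarrow> nat \<Rightarrow> real \<times> real \<Rightarrow> real \<times> real" where
  "Sq_affine p \<theta> t = (\<lambda>(x, y). (p t * x + Pq_beta p t, p (\<theta> t) * y + Pq_beta p (\<theta> t)))"

definition contracting_affine :: "('a::euclidean_space \<Rightarrow> 'a) \<Rightarrow> bool" where
  "contracting_affine g \<longleftrightarrow>
     (\<exists>L c. linear L \<and> bij L \<and> g = (\<lambda>z. L z + c)) \<and> (\<exists>C<1. C-lipschitz_on UNIV g)"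

text \<open>
  Compactness is not part of the notion, so that it also applies to graphs of discontinuous functions.
\<close>

definition self_affine_set :: "('a::euclidean_space) set \<Rightarrow> bool" where
  "self_affine_set S \<longleftrightarrow> S \<noteq> {} \<and>
     (\<exists>F. finite F \<and> 2 \<le> card F \<and> (\<forall>g\<in>F. contracting_affine g) \<and> S = (\<Union>g\<in>F. g ` S))"

text \<open>
  With the admissibility convention above, the graph \<open>\<Gamma>\<close> over the closed interval \<open>[0, 1]\<close> is in
  general not equal to the union of its images under the maps \<open>Sq_affine p \<theta> t\<close>: the image of the
  end point \<open>(1, f 1)\<close> for \<open>t < q - 1\<close> belongs to the excluded sequence \<open>t (q - 1) (q - 1) \<dots>\<close>,
  and \<open>f\<close> is evaluated there through \<open>(t + 1) 0 0 \<dots>\<close>. For \<open>q = 3\<close>, \<open>p = 1/3, 1/3, 1/3\<close> and \<open>\<theta>\<close>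
  exchanging 0 and 1, the point \<open>(1/3, 2/3)\<close> is in the union while \<open>f (1/3) = 1/6\<close>.
  These \<open>q - 1\<close> images are the only exceptions. The equation holds without change for the
  graph over \<open>[0, 1)\<close> and for the closure of \<open>\<Gamma>\<close>.
\<close>

end

theory Submission
  imports Defs
begin

text \<open>
  On \<open>[0, 1)\<close> the function \<open>f\<close> satisfies the functional equation
  \<open>f (\<beta>\<^sub>t + p\<^sub>t x) = \<beta>\<^bsub>\<theta> t\<^esub> + p\<^bsub>\<theta> t\<^esub> f x\<close> for every digit \<open>t\<close>: the left-hand argument has the
  expansion of \<open>x\<close> with \<open>t\<close> prepended (lemmas \<open>Pq_digits_cons\<close> and \<open>Sq_fun_affine\<close>). This rests on
  existence and uniqueness of expansions without a tail of digits \<open>q - 1\<close>, both of which follow from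
  the partition of \<open>[0, 1)\<close> into the cells \<open>[\<beta>\<^sub>t, \<beta>\<^sub>t + p\<^sub>t)\<close>, whose index is the leading digit. Since
  these cells are the images of \<open>[0, 1)\<close> under \<open>x \<mapsto> \<beta>\<^sub>t + p\<^sub>t x\<close>, the functional equation says
  exactly that \<open>\<Gamma>\<^sub>0\<close> is the union of its images \<open>\<psi>\<^sub>t(\<Gamma>\<^sub>0)\<close>.

  The point \<open>(1, f 1)\<close> is the fixed point of the contraction \<open>\<psi>\<^bsub>q - 1\<^esub>\<close>. Hence adding it to \<open>\<Gamma>\<^sub>0\<close>
  adds to the union only this point and its images under the other maps, and it is the limit of the iterates under
  \<open>\<psi>\<^bsub>q - 1\<^esub>\<close> of any point of \<open>\<Gamma>\<^sub>0\<close>, so that \<open>\<Gamma>\<close> and \<open>\<Gamma>\<^sub>0\<close> have the same closure. This closure is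
  compact because \<open>\<Gamma>\<^sub>0\<close> is bounded, so the union of its images is closed and contains \<open>\<Gamma>\<^sub>0\<close>;
  conversely each continuous \<open>\<psi>\<^sub>t\<close> maps \<open>\<Gamma>\<^sub>0\<close>, and hence its closure, into itself. The union
  formula therefore passes to the closure.
\<close>

section \<open>Values of digit sequences\<close>

text \<open>A probability vector \<open>p\<^sub>0, \<dots>, p\<^bsub>q - 1\<^esub>\<close> with entries in \<open>(0, 1)\<close>.\<close>

locale Pq_system =
  fixes q :: nat and p :: "nat \<Rightarrow> real"
  assumes q_gt_1: "q > 1"
    and p_bounds: "\<And>t. t < q \<Longrightarrow> 0 < p t \<and> p t < 1"
    and p_sum: "(\<Sum>t<q. p t) = 1"
begin

lemma p_pos: "t < q \<Longrightarrow> 0 < p t"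
  and p_less_1: "t < q \<Longrightarrow> p t < 1"
  using p_bounds by auto

lemma beta_0 [simp]: "Pq_beta p 0 = 0"
  by (simp add: Pq_beta_def)

lemma beta_Suc: "Pq_beta p (Suc t) = Pq_beta p t + p t"
  by (simp add: Pq_beta_def)

lemma beta_q: "Pq_beta p q = 1"
  using p_sum by (simp add: Pq_beta_def)

lemma beta_mono: "s \<le> t \<Longrightarrow> t \<le> q \<Longrightarrow> Pq_beta p s \<le> Pq_beta p t"
  unfolding Pq_beta_def by (rule sum_mono2) (auto simp: less_imp_le p_pos)

lemma beta_nonneg: "t \<le> q \<Longrightarrow> 0 \<le> Pq_beta p t"
  using beta_mono[of 0 t] by simp

lemma beta_Suc_le_1: "t < q \<Longrightarrow> Pq_beta p t + p t \<le> 1"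
  using beta_mono[of "Suc t" q] by (simp add: beta_Suc beta_q)

lemma beta_last: "Pq_beta p (q - 1) + p (q - 1) = 1"
  using beta_Suc[of "q - 1"] q_gt_1 by (simp add: beta_q)

lemma p_uniform_bound:
  obtains C where "0 < C" "C < 1" "\<And>t. t < q \<Longrightarrow> p t \<le> C"
proof
  have fin: "finite (p ` {..<q})" and ne: "p ` {..<q} \<noteq> {}"
    using q_gt_1 by auto
  show le: "p t \<le> Max (p ` {..<q})" if "t < q" for t
    using that fin by auto
  show "0 < Max (p ` {..<q})"
    using less_le_trans[OF p_pos le, of 0] q_gt_1 by simp
  show "Max (p ` {..<q}) < 1"
    using fin ne p_less_1 by auto
qed

lemma cylinder_length_tendsto_0:
  fixes i :: "nat \<Rightarrow> nat"
  assumes "\<And>k. i k < q"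
  shows "(\<lambda>n. \<Prod>r<n. p (i r)) \<longlonglongrightarrow> 0"
proof -
  obtain C where C: "0 < C" "C < 1" "\<And>t. t < q \<Longrightarrow> p t \<le> C"
    by (rule p_uniform_bound) blast
  have upper: "(\<Prod>r<n. p (i r)) \<le> C ^ n" for n
    using prod_mono[of "{..<n}" "\<lambda>r. p (i r)" "\<lambda>_. C"] C(3) assms
    by (simp add: less_imp_le p_pos)
  have lower: "0 \<le> (\<Prod>r<n. p (i r))" for n
    using assms by (intro prod_nonneg) (simp add: less_imp_le p_pos)
  have "(\<lambda>n. C ^ n) \<longlonglongrightarrow> 0"
    using C by (intro LIMSEQ_realpow_zero) auto
  then show ?thesis
    by (rule tendsto_sandwich[rotated 3, where f = "\<lambda>_. 0"])
      (use lower upper in auto)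
qed

text \<open>
  The left-hand side is the right end point of the interval of numbers whose first \<open>n\<close> digits are
  those of \<open>i\<close>; the last product is the length of this interval.
\<close>

lemma cylinder_right_end_le_1:
  fixes i :: "nat \<Rightarrow> nat"
  assumes "\<And>k. i k < q"
  shows "(\<Sum>k<n. Pq_beta p (i k) * (\<Prod>r<k. p (i r))) + (\<Prod>r<n. p (i r)) \<le> 1"
proof (induction n)
  case (Suc n)
  have "(\<Prod>r<n. p (i r)) * (Pq_beta p (i n) + p (i n)) \<le> (\<Prod>r<n. p (i r)) * 1"
    using assms beta_Suc_le_1
    by (intro mult_left_mono prod_nonneg) (auto intro: less_imp_le p_pos)
  with Suc show ?case
    by (simp add: algebra_simps)
qed simp

lemma value_term_nonneg:
  fixes i :: "nat \<Rightarrow> nat"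
  assumes "\<And>k. i k < q"
  shows "0 \<le> Pq_beta p (i k) * (\<Prod>r<k. p (i r))"
  using assms by (intro mult_nonneg_nonneg prod_nonneg beta_nonneg) (auto intro: less_imp_le p_pos)

lemma value_partial_sum_le_1:
  fixes i :: "nat \<Rightarrow> nat"
  assumes "\<And>k. i k < q"
  shows "(\<Sum>k<n. Pq_beta p (i k) * (\<Prod>r<k. p (i r))) \<le> 1"
proof -
  have "0 \<le> (\<Prod>r<n. p (i r))"
    using assms by (intro prod_nonneg) (auto intro: less_imp_le p_pos)
  with cylinder_right_end_le_1[of i n] assms show ?thesis
    by simp
qed

lemma value_summable:
  assumes "\<And>k. i k < q"
  shows "summable (\<lambda>k. Pq_beta p (i k) * (\<Prod>r<k. p (i r)))"
  by (rule summableI_nonneg_bounded[where x = 1])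
    (use assms value_term_nonneg value_partial_sum_le_1 in auto)

lemma value_bounds:
  assumes "\<And>k. i k < q"
  shows "0 \<le> Pq_value p i" "Pq_value p i \<le> 1"
  unfolding Pq_value_def
  using assms value_summable[of i] value_term_nonneg[of i] value_partial_sum_le_1[of i]
  by (auto intro: suminf_nonneg suminf_le_const)

lemma value_unfold:
  assumes "\<And>k. i k < q"
  shows "Pq_value p i = Pq_beta p (i 0) + p (i 0) * Pq_value p (\<lambda>k. i (Suc k))"
proof -
  let ?g = "\<lambda>k. Pq_beta p (i (Suc k)) * (\<Prod>r<k. p (i (Suc r)))"
  have "Pq_value p i
      = Pq_beta p (i 0) + (\<Sum>k. Pq_beta p (i (Suc k)) * (\<Prod>r<Suc k. p (i r)))"
    unfolding Pq_value_def using suminf_split_head[OF value_summable[of i]] assms by simp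
  also have "(\<lambda>k. Pq_beta p (i (Suc k)) * (\<Prod>r<Suc k. p (i r))) = (\<lambda>k. p (i 0) * ?g k)"
    by (simp add: prod.lessThan_Suc_shift mult_ac del: prod.lessThan_Suc)
  also have "(\<Sum>k. p (i 0) * ?g k) = p (i 0) * (\<Sum>k. ?g k)"
    using value_summable[of "\<lambda>k. i (Suc k)"] assms by (intro suminf_mult) simp
  finally show ?thesis
    by (simp add: Pq_value_def)
qed

lemma value_const_last: "Pq_value p (\<lambda>_. q - 1) = 1"
proof -
  have "Pq_value p (\<lambda>_. q - 1) = Pq_beta p (q - 1) + p (q - 1) * Pq_value p (\<lambda>_. q - 1)"
    using value_unfold[of "\<lambda>_. q - 1"] q_gt_1 by simp
  then have "(1 - p (q - 1)) * Pq_value p (\<lambda>_. q - 1) = (1 - p (q - 1)) * 1"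
    using beta_last by (simp add: algebra_simps)
  then show ?thesis
    using p_less_1[of "q - 1"] q_gt_1 by simp
qed

lemma value_less_1:
  assumes "\<And>k. i k < q" "i m \<noteq> q - 1"
  shows "Pq_value p i < 1"
  using assms
proof (induction m arbitrary: i)
  case 0
  then have "Suc (i 0) \<le> q - 1"
    using 0(1)[of 0] by linarith
  have "Pq_value p i \<le> Pq_beta p (i 0) + p (i 0) * 1"
    unfolding value_unfold[of i, OF 0(1)] using 0(1) value_bounds(2)[of "\<lambda>k. i (Suc k)"]
    by (intro add_left_mono mult_left_mono) (auto intro: less_imp_le p_pos)
  also have "\<dots> \<le> Pq_beta p (q - 1)"
    using beta_mono[OF \<open>Suc (i 0) \<le> q - 1\<close>] by (simp add: beta_Suc)
  also have "\<dots> < 1"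
    using beta_last p_pos[of "q - 1"] q_gt_1 by simp
  finally show ?case .
next
  case (Suc m)
  have "p (i 0) * Pq_value p (\<lambda>k. i (Suc k)) < p (i 0) * 1"
    using Suc.IH[of "\<lambda>k. i (Suc k)"] Suc.prems p_pos[of "i 0"] by (intro mult_strict_left_mono) auto
  then show ?case
    using value_unfold[of i] beta_Suc_le_1[of "i 0"] Suc.prems by simp
qed

section \<open>Existence and uniqueness of expansions\<close>

text \<open>
  Digit sequences without a tail of digits \<open>q - 1\<close>: the admissible expansions of the numbers in
  \<open>[0, 1)\<close>.
\<close>

definition proper :: "(nat \<Rightarrow> nat) \<Rightarrow> bool" where
  "proper i \<longleftrightarrow> (\<forall>k. i k < q) \<and> \<not> (\<exists>m. \<forall>k\<ge>m. i k = q - 1)"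

lemma admissible_iff: "Pq_admissible q i \<longleftrightarrow> i = (\<lambda>_. q - 1) \<or> proper i"
  unfolding Pq_admissible_def proper_def fun_eq_iff using q_gt_1 by auto

lemma proper_digit: "proper i \<Longrightarrow> i k < q"
  by (simp add: proper_def)

lemma proper_shift:
  assumes "proper i"
  shows "proper (\<lambda>k. i (Suc k))"
  unfolding proper_def
proof (intro conjI notI allI)
  assume "\<exists>m. \<forall>k\<ge>m. i (Suc k) = q - 1"
  then obtain m where m: "\<forall>k\<ge>m. i (Suc k) = q - 1" ..
  have "i k = q - 1" if "k \<ge> Suc m" for k
    using m[rule_format, of "k - 1"] that by simp
  with assms show False
    unfolding proper_def by blast
qed (use assms in \<open>simp add: proper_def\<close>)

lemma proper_cons:
  assumes "proper i" "t < q"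
  shows "proper (case_nat t i)"
  unfolding proper_def
proof (intro conjI notI allI)
  assume "\<exists>m. \<forall>k\<ge>m. case_nat t i k = q - 1"
  then obtain m where m: "\<forall>k\<ge>m. case_nat t i k = q - 1" ..
  have "i k = q - 1" if "k \<ge> m" for k
    using m[rule_format, of "Suc k"] that by simp
  with assms show False
    unfolding proper_def by blast
qed (use assms in \<open>auto simp: proper_def split: nat.split\<close>)

lemma value_cons:
  assumes "\<And>k. i k < q" "t < q"
  shows "Pq_value p (case_nat t i) = Pq_beta p t + p t * Pq_value p i"
  using value_unfold[of "case_nat t i"] assms by (simp split: nat.split)

lemma proper_value_less_1: "proper i \<Longrightarrow> Pq_value p i < 1"
  using value_less_1[of i] unfolding proper_def by blast

text \<open>
  The cells \<open>[\<beta>\<^sub>t, \<beta>\<^sub>t + p\<^sub>t)\<close> partition \<open>[0, 1)\<close>.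
\<close>

lemma cell_unique:
  assumes "s < q" "t < q" "Pq_beta p s \<le> x" "x < Pq_beta p s + p s"
    "Pq_beta p t \<le> x" "x < Pq_beta p t + p t"
  shows "s = t"
  using beta_mono[of "Suc s" t] beta_mono[of "Suc t" s] assms
  by (cases s t rule: linorder_cases) (auto simp: beta_Suc)

lemma cell_exists:
  assumes "0 \<le> x" "x < 1"
  obtains t where "t < q" "Pq_beta p t \<le> x" "x < Pq_beta p t + p t"
proof -
  define t where "t = (LEAST t. x < Pq_beta p (Suc t))"
  have last: "x < Pq_beta p (Suc (q - 1))"
    using assms q_gt_1 by (simp add: beta_q)
  have "x < Pq_beta p (Suc t)"
    unfolding t_def by (rule LeastI[of "\<lambda>t. x < Pq_beta p (Suc t)", OF last])
  moreover have "t < q"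
    using Least_le[of "\<lambda>t. x < Pq_beta p (Suc t)", OF last] q_gt_1 unfolding t_def by linarith
  moreover have "Pq_beta p t \<le> x"
  proof (cases t)
    case (Suc s)
    then show ?thesis
      using not_less_Least[of s "\<lambda>t. x < Pq_beta p (Suc t)"] by (simp add: t_def[symmetric])
  qed (use assms in simp)
  ultimately show thesis
    using that by (simp add: beta_Suc)
qed

lemma proper_value_in_cell:
  assumes "proper i"
  shows "Pq_beta p (i 0) \<le> Pq_value p i" "Pq_value p i < Pq_beta p (i 0) + p (i 0)"
proof -
  have shift: "proper (\<lambda>k. i (Suc k))"
    using assms by (rule proper_shift)
  have pos: "0 < p (i 0)"
    using assms by (intro p_pos proper_digit)
  have unfold: "Pq_value p i = Pq_beta p (i 0) + p (i 0) * Pq_value p (\<lambda>k. i (Suc k))"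
    using assms by (intro value_unfold proper_digit)
  show "Pq_beta p (i 0) \<le> Pq_value p i"
    unfolding unfold using pos value_bounds(1)[of "\<lambda>k. i (Suc k)"] proper_digit[OF assms] by simp
  show "Pq_value p i < Pq_beta p (i 0) + p (i 0)"
    unfolding unfold using pos proper_value_less_1[OF shift] by simp
qed

lemma proper_value_inj:
  assumes "proper i" "proper j" "Pq_value p i = Pq_value p j"
  shows "i = j"
proof
  fix k
  show "i k = j k"
    using assms
  proof (induction k arbitrary: i j)
    case 0
    show ?case
      using cell_unique[of "i 0" "j 0" "Pq_value p i"] proper_value_in_cell[OF 0(1)]
        proper_value_in_cell[OF 0(2)] proper_digit[OF 0(1)] proper_digit[OF 0(2)] 0(3) by simp
  next
    case (Suc k)
    have eq: "i 0 = j 0"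
      using cell_unique[of "i 0" "j 0" "Pq_value p i"] proper_value_in_cell[OF Suc.prems(1)]
        proper_value_in_cell[OF Suc.prems(2)] proper_digit[OF Suc.prems(1)]
        proper_digit[OF Suc.prems(2)] Suc.prems(3) by simp
    have "p (i 0) \<noteq> 0"
      using p_pos[of "i 0"] proper_digit[OF Suc.prems(1)] by force
    moreover have "Pq_value p i = Pq_beta p (i 0) + p (i 0) * Pq_value p (\<lambda>k. i (Suc k))"
      "Pq_value p j = Pq_beta p (j 0) + p (j 0) * Pq_value p (\<lambda>k. j (Suc k))"
      using value_unfold[of i] value_unfold[of j] Suc.prems(1,2) by (simp_all add: proper_digit)
    ultimately have "Pq_value p (\<lambda>k. i (Suc k)) = Pq_value p (\<lambda>k. j (Suc k))"
      using eq Suc.prems(3) by simp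
    then show ?case
      using Suc.IH[of "\<lambda>k. i (Suc k)" "\<lambda>k. j (Suc k)"] Suc.prems proper_shift by blast
  qed
qed

text \<open>
  Convergence of the digit algorithm: \<open>x n\<close> is an orbit of the expanding map that blows up each cell to \<open>[0, 1)\<close>, and \<open>d n\<close> is
  the index of the cell visited at time \<open>n\<close>.
\<close>

lemma value_of_orbit:
  assumes "\<And>n. 0 \<le> x n" "\<And>n. x n < 1" "\<And>n. d n < q"
    and step: "\<And>n. x n = Pq_beta p (d n) + p (d n) * x (Suc n)"
  shows "Pq_value p d = x 0"
proof -
  let ?S = "\<lambda>n. \<Sum>k<n. Pq_beta p (d k) * (\<Prod>r<k. p (d r))"
  let ?P = "\<lambda>n. \<Prod>r<n. p (d r)"
  \<comment> \<open>Unrolling \<open>step\<close> leaves a remainder bounded by the cylinder length, which tends to 0.\<close>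
  have partial: "x 0 = ?S n + ?P n * x n" for n
  proof (induction n)
    case (Suc n)
    then show ?case
      using step[of n] by (simp add: algebra_simps)
  qed simp
  have "(\<lambda>n. ?P n * x n) \<longlonglongrightarrow> 0"
  proof (rule tendsto_sandwich[where f = "\<lambda>_. 0" and h = ?P])
    have P: "0 \<le> ?P n" for n
      using assms(3) by (intro prod_nonneg) (auto intro: less_imp_le p_pos)
    show "\<forall>\<^sub>F n in sequentially. 0 \<le> ?P n * x n"
      using P assms(1) by simp
    show "\<forall>\<^sub>F n in sequentially. ?P n * x n \<le> ?P n"
      using P assms(2) by (simp add: mult_left_le less_imp_le)
    show "?P \<longlonglongrightarrow> 0"
      using assms(3) by (rule cylinder_length_tendsto_0)
  qed simp
  then have "(\<lambda>n. x 0 - ?P n * x n) \<longlonglongrightarrow> x 0 - 0"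
    by (intro tendsto_diff tendsto_const)
  moreover have "(\<lambda>n. x 0 - ?P n * x n) = ?S"
  proof
    show "x 0 - ?P n * x n = ?S n" for n
      using partial[of n] by linarith
  qed
  ultimately have "?S \<longlonglongrightarrow> x 0"
    by simp
  moreover have "?S \<longlonglongrightarrow> Pq_value p d"
    unfolding Pq_value_def using summable_LIMSEQ[OF value_summable[of d]] assms(3) by simp
  ultimately show ?thesis
    by (rule LIMSEQ_unique[symmetric])
qed

lemma proper_exists:
  assumes "0 \<le> x" "x < 1"
  obtains i where "proper i" "Pq_value p i = x"
proof -
  \<comment> \<open>\<open>D y\<close> is the index of the cell of \<open>y\<close>, and \<open>T\<close> blows up each cell to \<open>[0, 1)\<close>.\<close>
  define D where "D y = (SOME t. t < q \<and> Pq_beta p t \<le> y \<and> y < Pq_beta p t + p t)" for y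
  have D: "D y < q \<and> Pq_beta p (D y) \<le> y \<and> y < Pq_beta p (D y) + p (D y)"
    if "0 \<le> y" "y < 1" for y
    unfolding D_def by (rule someI_ex) (use cell_exists[OF that] in blast)
  define T where "T y = (y - Pq_beta p (D y)) / p (D y)" for y
  have T: "0 \<le> T y \<and> T y < 1" if "0 \<le> y" "y < 1" for y
    using D[OF that] p_pos[of "D y"] unfolding T_def by (simp add: field_simps)
  define X where "X n = (T ^^ n) x" for n
  have X: "0 \<le> X n \<and> X n < 1" for n
    unfolding X_def by (induction n) (use assms T in auto)
  define d where "d n = D (X n)" for n
  have d: "d n < q" for n
    using D X by (simp add: d_def)
  have step: "X n = Pq_beta p (d n) + p (d n) * X (Suc n)" for n
    using p_pos[OF d[of n]] unfolding d_def by (simp add: X_def T_def)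
  have value_tail: "Pq_value p (\<lambda>k. d (m + k)) = X m" for m
  proof -
    have "X (m + n) = Pq_beta p (d (m + n)) + p (d (m + n)) * X (m + Suc n)" for n
      using step[of "m + n"] by (simp only: add_Suc_right)
    then have "Pq_value p (\<lambda>k. d (m + k)) = X (m + 0)"
      using d by (intro value_of_orbit conjunct1[OF X] conjunct2[OF X])
    then show ?thesis
      by simp
  qed
  have "proper d"
    unfolding proper_def
  proof (intro conjI notI allI)
    assume "\<exists>m. \<forall>k\<ge>m. d k = q - 1"
    then obtain m where "\<forall>k\<ge>m. d k = q - 1" ..
    \<comment> \<open>A tail of digits \<open>q - 1\<close> has value 1, but the orbit stays in \<open>[0, 1)\<close>.\<close>
    then have "X m = 1"
      using value_tail[of m] value_const_last by simp
    with X[of m] show False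
      by simp
  qed (rule d)
  moreover have "Pq_value p d = x"
    using value_tail[of 0] by (simp add: X_def)
  ultimately show thesis
    by (rule that)
qed

lemma Pq_digits_eq:
  assumes "proper i"
  shows "Pq_digits p q (Pq_value p i) = i"
  unfolding Pq_digits_def
proof (rule the_equality)
  show "Pq_admissible q i \<and> Pq_value p i = Pq_value p i"
    using assms by (simp add: admissible_iff)
next
  fix j
  assume "Pq_admissible q j \<and> Pq_value p j = Pq_value p i"
  then show "j = i"
    using assms proper_value_inj[of j i] proper_value_less_1[OF assms] value_const_last
    by (auto simp: admissible_iff)
qed

lemma Pq_digits_proper:
  assumes "0 \<le> x" "x < 1"
  shows "proper (Pq_digits p q x)" "Pq_value p (Pq_digits p q x) = x"
proof -
  obtain i where "proper i" "Pq_value p i = x"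
    using proper_exists[OF assms] .
  then show "proper (Pq_digits p q x)" "Pq_value p (Pq_digits p q x) = x"
    using Pq_digits_eq[of i] by auto
qed

lemma Pq_digits_1: "Pq_digits p q 1 = (\<lambda>_. q - 1)"
  unfolding Pq_digits_def
proof (rule the_equality)
  show "Pq_admissible q (\<lambda>_. q - 1) \<and> Pq_value p (\<lambda>_. q - 1) = 1"
    by (simp only: admissible_iff value_const_last simp_thms)
next
  fix j
  assume "Pq_admissible q j \<and> Pq_value p j = 1"
  then show "j = (\<lambda>_. q - 1)"
    using proper_value_less_1[of j] by (auto simp: admissible_iff)
qed

lemma Pq_digits_cons:
  assumes "0 \<le> x" "x < 1" "t < q"
  shows "Pq_digits p q (Pq_beta p t + p t * x) = case_nat t (Pq_digits p q x)"
proof -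
  let ?i = "Pq_digits p q x"
  have "Pq_value p (case_nat t ?i) = Pq_beta p t + p t * x"
    using value_cons[of ?i t] Pq_digits_proper[OF assms(1,2)] assms(3) by (simp add: proper_digit)
  then show ?thesis
    using Pq_digits_eq[OF proper_cons, of ?i t] Pq_digits_proper(1)[OF assms(1,2)] assms(3)
    by simp
qed

lemma affine_in_unit_interval:
  assumes "0 \<le> x" "x < 1" "t < q"
  shows "0 \<le> Pq_beta p t + p t * x" "Pq_beta p t + p t * x < 1"
proof -
  show "0 \<le> Pq_beta p t + p t * x"
    using assms by (simp add: beta_nonneg p_pos less_imp_le)
  have "p t * x < p t * 1"
    using assms p_pos by (intro mult_strict_left_mono) auto
  then show "Pq_beta p t + p t * x < 1"
    using beta_Suc_le_1[OF assms(3)] by simp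
qed

end

section \<open>The functional equation and the graph\<close>

text \<open>The data of one function of the class \<open>S\<^sub>q\<close>: a probability vector and a digit permutation.\<close>

locale Pq_digit_permutation = Pq_system +
  fixes \<theta> :: "nat \<Rightarrow> nat"
  assumes perm: "\<theta> permutes {..<q}"
begin

lemma perm_less: "t < q \<Longrightarrow> \<theta> t < q"
  using permutes_in_image[OF perm, of t] by simp

lemma Sq_fun_affine:
  assumes "0 \<le> x" "x < 1" "t < q"
  shows "Sq_fun p q \<theta> (Pq_beta p t + p t * x) = Pq_beta p (\<theta> t) + p (\<theta> t) * Sq_fun p q \<theta> x"
proof -
  have "\<theta> \<circ> case_nat t (Pq_digits p q x) = case_nat (\<theta> t) (\<theta> \<circ> Pq_digits p q x)"
    by (auto split: nat.split)
  then show ?thesis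
    unfolding Sq_fun_def Pq_digits_cons[OF assms]
    using value_cons[of "\<theta> \<circ> Pq_digits p q x" "\<theta> t"] Pq_digits_proper(1)[OF assms(1,2)] assms(3)
    by (simp add: perm_less proper_digit)
qed

lemma Sq_fun_bounds:
  assumes "0 \<le> x" "x < 1"
  shows "0 \<le> Sq_fun p q \<theta> x" "Sq_fun p q \<theta> x \<le> 1"
  unfolding Sq_fun_def
  using value_bounds[of "\<theta> \<circ> Pq_digits p q x"] Pq_digits_proper(1)[OF assms]
  by (simp_all add: perm_less proper_digit)

lemma affine_last_fixed_point:
  "Sq_affine p \<theta> (q - 1) (1, Sq_fun p q \<theta> 1) = (1, Sq_fun p q \<theta> 1)"
proof -
  have "Sq_fun p q \<theta> 1 = Pq_value p (\<lambda>_. \<theta> (q - 1))"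
    unfolding Sq_fun_def Pq_digits_1 by (simp add: comp_def)
  moreover have "\<theta> (q - 1) < q"
    using q_gt_1 by (intro perm_less) simp
  ultimately show ?thesis
    using value_unfold[of "\<lambda>_. \<theta> (q - 1)"] beta_last by (simp add: Sq_affine_def algebra_simps)
qed

lemma graph_Ico_invariant:
  "graph_on {0..<1} (Sq_fun p q \<theta>) = (\<Union>t<q. Sq_affine p \<theta> t ` graph_on {0..<1} (Sq_fun p q \<theta>))"
    (is "?G = ?U")
proof (intro equalityI subsetI)
  fix z
  assume "z \<in> ?G"
  then obtain y where y: "0 \<le> y" "y < 1" "z = (y, Sq_fun p q \<theta> y)"
    by (auto simp: graph_on_def)
  obtain t where t: "t < q" "Pq_beta p t \<le> y" "y < Pq_beta p t + p t"
    using cell_exists[OF y(1,2)] .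
  define x where "x = (y - Pq_beta p t) / p t"
  have x: "0 \<le> x" "x < 1" "y = Pq_beta p t + p t * x"
    using t p_pos[OF t(1)] by (auto simp: x_def field_simps)
  have "z = Sq_affine p \<theta> t (x, Sq_fun p q \<theta> x)"
    using Sq_fun_affine[OF x(1,2) t(1)] y(3) x(3) by (simp add: Sq_affine_def algebra_simps)
  moreover have "(x, Sq_fun p q \<theta> x) \<in> ?G"
    using x by (simp add: graph_on_def)
  ultimately show "z \<in> ?U"
    using t(1) by blast
next
  fix z
  assume "z \<in> ?U"
  then obtain t x where tx: "t < q" "0 \<le> x" "x < 1" "z = Sq_affine p \<theta> t (x, Sq_fun p q \<theta> x)"
    by (auto simp: graph_on_def)
  have "z = (Pq_beta p t + p t * x, Sq_fun p q \<theta> (Pq_beta p t + p t * x))"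
    using Sq_fun_affine[OF tx(2,3,1)] tx(4) by (simp add: Sq_affine_def algebra_simps)
  then show "z \<in> ?G"
    using affine_in_unit_interval[OF tx(2,3,1)] by (auto simp: graph_on_def)
qed

lemma graph_Icc_eq:
  "graph_on {0..1} (Sq_fun p q \<theta>)
    = insert (1, Sq_fun p q \<theta> 1) (graph_on {0..<1} (Sq_fun p q \<theta>))"
proof -
  have "{0..1::real} = insert 1 {0..<1}"
    by auto
  then show ?thesis
    by (simp add: graph_on_def)
qed

lemma graph_Icc_images:
  "(\<Union>t<q. Sq_affine p \<theta> t ` graph_on {0..1} (Sq_fun p q \<theta>))
    = graph_on {0..1} (Sq_fun p q \<theta>)
      \<union> (\<lambda>t. Sq_affine p \<theta> t (1, Sq_fun p q \<theta> 1)) ` {..<q - 1}"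
proof -
  let ?e = "(1, Sq_fun p q \<theta> 1)" and ?G = "graph_on {0..<1} (Sq_fun p q \<theta>)"
  have "{..<q} = insert (q - 1) {..<q - 1}"
    using q_gt_1 by auto
  then have "(\<lambda>t. Sq_affine p \<theta> t ?e) ` {..<q}
      = insert ?e ((\<lambda>t. Sq_affine p \<theta> t ?e) ` {..<q - 1})"
    using affine_last_fixed_point by (metis image_insert)
  moreover have "(\<Union>t<q. Sq_affine p \<theta> t ` insert ?e ?G)
      = (\<lambda>t. Sq_affine p \<theta> t ?e) ` {..<q} \<union> (\<Union>t<q. Sq_affine p \<theta> t ` ?G)"
    by auto
  ultimately show ?thesis
    unfolding graph_Icc_eq graph_Ico_invariant[symmetric] by auto
qed

lemma endpoint_in_closure:
  "(1, Sq_fun p q \<theta> 1) \<in> closure (graph_on {0..<1} (Sq_fun p q \<theta>))"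
proof -
  let ?f = "Sq_fun p q \<theta>" and ?\<psi> = "Sq_affine p \<theta> (q - 1)"
  define a b where "a = p (q - 1)" and "b = p (\<theta> (q - 1))"
  have q: "q - 1 < q"
    using q_gt_1 by simp
  have a: "0 < a" "a < 1" and b: "0 < b" "b < 1"
    using p_bounds[OF q] p_bounds[OF perm_less[OF q]] by (auto simp: a_def b_def)
  have fixed: "a + Pq_beta p (q - 1) = 1" "b * ?f 1 + Pq_beta p (\<theta> (q - 1)) = ?f 1"
    using affine_last_fixed_point by (auto simp: Sq_affine_def a_def b_def)
  \<comment> \<open>The iterates of a graph point stay in the graph and converge to the fixed point \<open>(1, f 1)\<close>.\<close>
  define z where "z n = (?\<psi> ^^ n) (0, ?f 0)" for n
  have "z n \<in> graph_on {0..<1} ?f" for n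
  proof (induction n)
    case 0
    show ?case
      by (simp add: z_def graph_on_def)
  next
    case (Suc n)
    then have "?\<psi> (z n) \<in> graph_on {0..<1} ?f"
      using q graph_Ico_invariant by blast
    then show ?case
      by (simp add: z_def)
  qed
  moreover have z: "z n = (1 + a ^ n * (0 - 1), ?f 1 + b ^ n * (?f 0 - ?f 1))" for n
  proof (induction n)
    case (Suc n)
    have "z (Suc n) = ?\<psi> (z n)"
      by (simp add: z_def)
    also have "\<dots> = (a * (1 + a ^ n * (0 - 1)) + Pq_beta p (q - 1),
        b * (?f 1 + b ^ n * (?f 0 - ?f 1)) + Pq_beta p (\<theta> (q - 1)))"
      unfolding Suc by (simp add: Sq_affine_def a_def b_def)
    also have "\<dots> = ((a + Pq_beta p (q - 1)) + a ^ Suc n * (0 - 1),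
        (b * ?f 1 + Pq_beta p (\<theta> (q - 1))) + b ^ Suc n * (?f 0 - ?f 1))"
      by (simp add: algebra_simps)
    finally show ?case
      unfolding fixed .
  qed (simp add: z_def)
  moreover have "(\<lambda>n. a ^ n) \<longlonglongrightarrow> 0" "(\<lambda>n. b ^ n) \<longlonglongrightarrow> 0"
    using a b by (auto intro: LIMSEQ_realpow_zero)
  then have "(\<lambda>n. (1 + a ^ n * (0 - 1), ?f 1 + b ^ n * (?f 0 - ?f 1)))
      \<longlonglongrightarrow> (1 + 0 * (0 - 1), ?f 1 + 0 * (?f 0 - ?f 1))"
    by (intro tendsto_Pair tendsto_add tendsto_mult tendsto_const)
  then have "z \<longlonglongrightarrow> (1, ?f 1)"
    unfolding z[THEN ext[of z], symmetric] by simp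
  ultimately show ?thesis
    unfolding closure_sequential by blast
qed

lemma closure_graph_Icc:
  "closure (graph_on {0..1} (Sq_fun p q \<theta>)) = closure (graph_on {0..<1} (Sq_fun p q \<theta>))"
  using endpoint_in_closure closure_mono[of "graph_on {0..<1} (Sq_fun p q \<theta>)"]
  unfolding graph_Icc_eq
  by (intro equalityI closure_minimal) (auto intro: subsetD[OF closure_subset])

lemma bounded_graph_Ico: "bounded (graph_on {0..<1} (Sq_fun p q \<theta>))"
proof (rule bounded_subset)
  show "bounded ({0..1::real} \<times> {0..1::real})"
    by (intro bounded_Times) auto
  show "graph_on {0..<1} (Sq_fun p q \<theta>) \<subseteq> {0..1} \<times> {0..1}"
    using Sq_fun_bounds by (auto simp: graph_on_def)
qed

lemma closure_graph_invariant:
  "closure (graph_on {0..<1} (Sq_fun p q \<theta>))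
    = (\<Union>t<q. Sq_affine p \<theta> t ` closure (graph_on {0..<1} (Sq_fun p q \<theta>)))"
proof -
  let ?G = "graph_on {0..<1} (Sq_fun p q \<theta>)"
  have cont: "continuous_on S (Sq_affine p \<theta> t)" for S t
    unfolding Sq_affine_def case_prod_beta by (intro continuous_intros)
  have closed_images: "closed (\<Union>t<q. Sq_affine p \<theta> t ` closure ?G)"
    using cont bounded_graph_Ico
    by (intro closed_UN) (auto intro!: compact_imp_closed compact_continuous_image)
  show ?thesis
  proof (rule equalityI)
    have "?G \<subseteq> (\<Union>t<q. Sq_affine p \<theta> t ` closure ?G)"
      by (subst graph_Ico_invariant) (use closure_subset in blast)
    then show "closure ?G \<subseteq> (\<Union>t<q. Sq_affine p \<theta> t ` closure ?G)"
      using closed_images by (rule closure_minimal)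
    show "(\<Union>t<q. Sq_affine p \<theta> t ` closure ?G) \<subseteq> closure ?G"
    proof (rule UN_least)
      fix t
      assume "t \<in> {..<q}"
      then have "Sq_affine p \<theta> t ` ?G \<subseteq> ?G"
        using graph_Ico_invariant by blast
      then show "Sq_affine p \<theta> t ` closure ?G \<subseteq> closure ?G"
        by (intro image_closure_subset cont closed_closure subset_trans[OF _ closure_subset])
    qed
  qed
qed

lemma contracting_affine_Sq_affine:
  assumes "t < q"
  shows "contracting_affine (Sq_affine p \<theta> t)"
proof -
  define a b where "a = p t" and "b = p (\<theta> t)"
  have a: "0 < a" "a < 1" and b: "0 < b" "b < 1"
    using p_bounds[OF assms] p_bounds[OF perm_less[OF assms]] by (auto simp: a_def b_def)
  define L where "L = (\<lambda>z::real \<times> real. (a * fst z, b * snd z))"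
  have linear: "linear L"
    by (rule linearI) (auto simp: L_def algebra_simps)
  have bij: "bij L"
    by (rule o_bij[where g = "\<lambda>z. (fst z / a, snd z / b)"]) (use a b in \<open>auto simp: L_def\<close>)
  have affine: "Sq_affine p \<theta> t = (\<lambda>z. L z + (Pq_beta p t, Pq_beta p (\<theta> t)))"
    by (auto simp: Sq_affine_def L_def a_def b_def)
  have norm_L: "norm (L z) \<le> max a b * norm z" for z
  proof -
    have "(norm (L z))\<^sup>2 = a\<^sup>2 * (fst z)\<^sup>2 + b\<^sup>2 * (snd z)\<^sup>2"
      by (simp add: L_def norm_Pair power_mult_distrib)
    also have "\<dots> \<le> (max a b)\<^sup>2 * (fst z)\<^sup>2 + (max a b)\<^sup>2 * (snd z)\<^sup>2"
      using a b by (intro add_mono mult_right_mono power_mono) auto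
    also have "\<dots> = (max a b * norm z)\<^sup>2"
      by (simp add: norm_prod_def algebra_simps)
    finally show ?thesis
      using a by (intro power2_le_imp_le[of "norm (L z)"]) auto
  qed
  have "(max a b)-lipschitz_on UNIV (Sq_affine p \<theta> t)"
  proof (rule lipschitz_onI)
    fix u v :: "real \<times> real"
    show "dist (Sq_affine p \<theta> t u) (Sq_affine p \<theta> t v) \<le> max a b * dist u v"
      using norm_L[of "u - v"] by (simp add: affine dist_norm linear_diff[OF linear])
  qed (use a in simp)
  moreover have "max a b < 1"
    using a b by simp
  ultimately show ?thesis
    unfolding contracting_affine_def using linear bij affine by blast
qed

lemma self_affine_setI:
  assumes "S \<noteq> {}" "S = (\<Union>t<q. Sq_affine p \<theta> t ` S)"
  shows "self_affine_set S"
proof -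
  let ?F = "Sq_affine p \<theta> ` {..<q}"
  have "Sq_affine p \<theta> 0 (0, 0) \<noteq> Sq_affine p \<theta> 1 (0, 0)"
    using beta_Suc[of 0] p_pos[of 0] q_gt_1 by (simp add: Sq_affine_def)
  then have "Sq_affine p \<theta> 0 \<noteq> Sq_affine p \<theta> 1"
    by auto
  then have "card {Sq_affine p \<theta> 0, Sq_affine p \<theta> 1} = 2"
    by simp
  moreover have "{Sq_affine p \<theta> 0, Sq_affine p \<theta> 1} \<subseteq> ?F"
    using q_gt_1 by auto
  ultimately have "2 \<le> card ?F"
    using card_mono[of ?F "{Sq_affine p \<theta> 0, Sq_affine p \<theta> 1}"] by simp
  moreover have "S = (\<Union>g\<in>?F. g ` S)"
    using assms(2) by simp
  ultimately show ?thesis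
    unfolding self_affine_set_def using assms(1) contracting_affine_Sq_affine by blast
qed

end

theorem theorem2:
  fixes q :: nat and p :: "nat \<Rightarrow> real" and \<theta> :: "nat \<Rightarrow> nat"
    and f :: "real \<Rightarrow> real" and \<psi> :: "nat \<Rightarrow> real \<times> real \<Rightarrow> real \<times> real"
    and \<Gamma> \<Gamma>\<^sub>0 :: "(real \<times> real) set"
  assumes "q > 1"
    and "\<And>t. t < q \<Longrightarrow> 0 < p t \<and> p t < 1"
    and "(\<Sum>t<q. p t) = 1"
    and "\<theta> permutes {..<q}"
  defines "f \<equiv> Sq_fun p q \<theta>"
    and "\<psi> \<equiv> Sq_affine p \<theta>"
    and "\<Gamma> \<equiv> graph_on {0..1} f"
    and "\<Gamma>\<^sub>0 \<equiv> graph_on {0..<1} f"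
  shows "(\<Union>t<q. \<psi> t ` \<Gamma>) = \<Gamma> \<union> (\<lambda>t. \<psi> t (1, f 1)) ` {..<q - 1}
    \<and> self_affine_set \<Gamma>\<^sub>0 \<and> \<Gamma>\<^sub>0 = (\<Union>t<q. \<psi> t ` \<Gamma>\<^sub>0)
    \<and> compact (closure \<Gamma>) \<and> self_affine_set (closure \<Gamma>)
    \<and> closure \<Gamma> = (\<Union>t<q. \<psi> t ` closure \<Gamma>)"
proof -
  interpret Pq_digit_permutation q p \<theta>
    using assms(1-4) by unfold_locales auto
  have nonempty: "\<Gamma>\<^sub>0 \<noteq> {}"
    by (simp add: \<Gamma>\<^sub>0_def graph_on_def)
  have closure_eq: "closure \<Gamma> = closure \<Gamma>\<^sub>0"
    unfolding \<Gamma>_def \<Gamma>\<^sub>0_def f_def by (rule closure_graph_Icc)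
  have images: "(\<Union>t<q. \<psi> t ` \<Gamma>) = \<Gamma> \<union> (\<lambda>t. \<psi> t (1, f 1)) ` {..<q - 1}"
    unfolding \<Gamma>_def \<psi>_def f_def by (rule graph_Icc_images)
  have inv: "\<Gamma>\<^sub>0 = (\<Union>t<q. \<psi> t ` \<Gamma>\<^sub>0)"
    unfolding \<Gamma>\<^sub>0_def \<psi>_def f_def by (rule graph_Ico_invariant)
  have inv_closure: "closure \<Gamma> = (\<Union>t<q. \<psi> t ` closure \<Gamma>)"
    unfolding closure_eq unfolding \<Gamma>\<^sub>0_def \<psi>_def f_def by (rule closure_graph_invariant)
  have "compact (closure \<Gamma>)"
    unfolding closure_eq using bounded_graph_Ico by (simp add: \<Gamma>\<^sub>0_def f_def)
  moreover have "self_affine_set \<Gamma>\<^sub>0"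
    using nonempty inv unfolding \<psi>_def by (rule self_affine_setI)
  moreover have "closure \<Gamma> \<noteq> {}"
    using nonempty closure_eq by simp
  then have "self_affine_set (closure \<Gamma>)"
    using inv_closure unfolding \<psi>_def by (rule self_affine_setI)
  ultimately show ?thesis
    using images inv inv_closure by (intro conjI)
qed

end
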